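(* Let $M[P,Q]$ be a lattice path matroid of rank $r$ and nullity $m$ with no isthmuses, with standard presentation $(N_1,\ldots,N_r)$, $N_i=[l_i,g_i]$. Then the maximal presentation of $M[P,Q]$ is $(N'_1,\ldots,N'_r)$ where $N'_i=N_i\cup I_i^+\cup I_i^-$ and $$I_i^+=\{g_i+j : j>0 \text{ and } g_i+j \text{ is the greatest element of } N_{i+j}\},\qquad I_i^-=\{l_i-j : j>0 \text{ and } l_i-j \text{ is the least element of } N_{i-j}\}.$$
   Context: Lattice paths start at $(0,0)$ and use steps $E=(1,0)$ and $N=(0,1)$. For lattice paths $P,Q$ from $(0,0)$ to $(m,r)$ with $P$ never going above $Q$, let $\mathcal{P}$ be the set of lattice paths from $(0,0)$ to $(m,r)$ going neither above $Q$ nor below $P$, and for $1\le i\le r$ let $N_i=\{j:\text{step } j \text{ is the } i\text{-th North step of some path in }\mathcal{P}\}$; each $N_i$ is an interval $[l_i,g_i]$ of $[m+r]$. $M[P,Q]$ is the transversal matroid on $[m+r]$ with presentation $(N_1,\ldots,N_r)$, its standard presentation. A presentation of a rank-$r$ transversal matroid $M$ is a multiset $(A_1,\ldots,A_r)$ of subsets of $E(M)$ whose maximal partial transversals are the bases of $M$; it is maximal if the only presentation $(A'_1,\ldots,A'_r)$ of $M$ with $A_i\subseteq A'_i$ for all $i$ is $(A_1,\ldots,A_r)$ itself. Every transversal matroid has a unique maximal presentation. *)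

theory Defs
  imports "HOL-Library.Multiset"
begin

section \<open>Matroids and presentations\<close>

text \<open>
  Only the data of a matroid (ground set and bases) is recorded. The matroids considered are
  all of the form \<open>transversal_matroid S \<A>\<close>, for which the basis axioms are a theorem.
\<close>

record 'a matroid =
  ground :: "'a set"
  bases :: "'a set set"

text \<open>All bases of a matroid on a finite ground set have the same size, so \<open>Max\<close> picks that size.\<close>

definition rank :: "'a matroid \<Rightarrow> nat" where
  "rank M = Max (card ` bases M)"

definition isthmus :: "'a matroid \<Rightarrow> 'a \<Rightarrow> bool" where
  "isthmus M e \<longleftrightarrow> e \<in> ground M \<and> (\<forall>B\<in>bases M. e \<in> B)"

text \<open>
  A set system \<open>(A\<^sub>1, \<dots>, A\<^sub>r)\<close> is a multiset of sets. The list \<open>As\<close> below is an arbitrary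
  indexing of it; the choice is immaterial.
\<close>

definition partial_transversal :: "'a set multiset \<Rightarrow> 'a set \<Rightarrow> bool" where
  "partial_transversal \<A> X \<longleftrightarrow>
     (\<exists>As \<phi>. mset As = \<A> \<and> inj_on \<phi> X \<and> (\<forall>x\<in>X. \<phi> x < length As \<and> x \<in> As ! \<phi> x))"

definition maximal_partial_transversals :: "'a set multiset \<Rightarrow> 'a set set" where
  "maximal_partial_transversals \<A> =
     {B. partial_transversal \<A> B \<and> (\<forall>X. partial_transversal \<A> X \<and> B \<subseteq> X \<longrightarrow> X = B)}"

definition transversal_matroid :: "'a set \<Rightarrow> 'a set multiset \<Rightarrow> 'a matroid" where
  "transversal_matroid S \<A> = \<lparr>ground = S, bases = maximal_partial_transversals \<A>\<rparr>"

definition presentation :: "'a matroid \<Rightarrow> 'a set multiset \<Rightarrow> bool" where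
  "presentation M \<A> \<longleftrightarrow>
     size \<A> = rank M \<and> (\<forall>A\<in>#\<A>. A \<subseteq> ground M) \<and> bases M = maximal_partial_transversals \<A>"

text \<open>
  \<open>rel_mset (\<subseteq>) \<A> \<A>'\<close> says that the two multisets can be indexed as \<open>(A\<^sub>i)\<close> and \<open>(A'\<^sub>i)\<close> with
  \<open>A\<^sub>i \<subseteq> A'\<^sub>i\<close> for all \<open>i\<close>.
\<close>

definition maximal_presentation :: "'a matroid \<Rightarrow> 'a set multiset \<Rightarrow> bool" where
  "maximal_presentation M \<A> \<longleftrightarrow>
     presentation M \<A> \<and> (\<forall>\<A>'. presentation M \<A>' \<and> rel_mset (\<subseteq>) \<A> \<A>' \<longrightarrow> \<A>' = \<A>)"


section \<open>Lattice paths\<close>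

datatype step = East | North

definition lattice_path :: "nat \<Rightarrow> nat \<Rightarrow> step list \<Rightarrow> bool" where
  "lattice_path m r P \<longleftrightarrow> count_list P East = m \<and> count_list P North = r"

definition path_points :: "step list \<Rightarrow> (nat \<times> nat) set" where
  "path_points P =
     {(count_list (take k P) East, count_list (take k P) North) | k. k \<le> length P}"

text \<open>
  Every lattice point of \<open>P\<close> has a point of \<open>Q\<close> weakly above it on the same vertical line.
  For two paths with the same endpoints, this is the same as \<open>Q\<close> never going below \<open>P\<close>.
\<close>

definition never_above :: "step list \<Rightarrow> step list \<Rightarrow> bool" where
  "never_above P Q \<longleftrightarrow> (\<forall>(x, y)\<in>path_points P. \<exists>y'\<ge>y. (x, y') \<in> path_points Q)"

definition paths_between :: "nat \<Rightarrow> nat \<Rightarrow> step list \<Rightarrow> step list \<Rightarrow> step list set" where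
  "paths_between m r P Q = {R. lattice_path m r R \<and> never_above P R \<and> never_above R Q}"

text \<open>Steps are numbered from 1, whereas list positions are numbered from 0.\<close>

definition is_north_step :: "step list \<Rightarrow> nat \<Rightarrow> nat \<Rightarrow> bool" where
  "is_north_step R i j \<longleftrightarrow>
     1 \<le> j \<and> j \<le> length R \<and> R ! (j - 1) = North \<and> count_list (take j R) North = i"

definition north_set :: "nat \<Rightarrow> nat \<Rightarrow> step list \<Rightarrow> step list \<Rightarrow> nat \<Rightarrow> nat set" where
  "north_set m r P Q i = {j. \<exists>R\<in>paths_between m r P Q. is_north_step R i j}"

definition standard_presentation ::
  "nat \<Rightarrow> nat \<Rightarrow> step list \<Rightarrow> step list \<Rightarrow> nat set multiset" where
  "standard_presentation m r P Q = image_mset (north_set m r P Q) (mset_set {1..r})"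

definition lattice_path_matroid ::
  "nat \<Rightarrow> nat \<Rightarrow> step list \<Rightarrow> step list \<Rightarrow> nat matroid" where
  "lattice_path_matroid m r P Q =
     transversal_matroid {1..m + r} (standard_presentation m r P Q)"

text \<open>The endpoints of the interval \<open>N\<^sub>i = [l\<^sub>i, g\<^sub>i]\<close>, for \<open>1 \<le> i \<le> r\<close>.\<close>

definition least_north :: "nat \<Rightarrow> nat \<Rightarrow> step list \<Rightarrow> step list \<Rightarrow> nat \<Rightarrow> nat" where
  "least_north m r P Q i = Min (north_set m r P Q i)"

definition greatest_north :: "nat \<Rightarrow> nat \<Rightarrow> step list \<Rightarrow> step list \<Rightarrow> nat \<Rightarrow> nat" where
  "greatest_north m r P Q i = Max (north_set m r P Q i)"

text \<open>
  The bounds \<open>i + j \<le> r\<close> and \<open>j < i\<close> say that \<open>N\<^bsub>i+j\<^esub>\<close> and \<open>N\<^bsub>i-j\<^esub>\<close> are members of the standard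
  presentation. The subtraction \<open>l\<^sub>i - j\<close> is not truncated, since \<open>j < i \<le> l\<^sub>i\<close>.
\<close>

definition I_plus :: "nat \<Rightarrow> nat \<Rightarrow> step list \<Rightarrow> step list \<Rightarrow> nat \<Rightarrow> nat set" where
  "I_plus m r P Q i =
     {greatest_north m r P Q i + j | j.
        0 < j \<and> i + j \<le> r \<and> greatest_north m r P Q i + j = greatest_north m r P Q (i + j)}"

definition I_minus :: "nat \<Rightarrow> nat \<Rightarrow> step list \<Rightarrow> step list \<Rightarrow> nat \<Rightarrow> nat set" where
  "I_minus m r P Q i =
     {least_north m r P Q i - j | j.
        0 < j \<and> j < i \<and> least_north m r P Q i - j = least_north m r P Q (i - j)}"

definition extended_north_set :: "nat \<Rightarrow> nat \<Rightarrow> step list \<Rightarrow> step list \<Rightarrow> nat \<Rightarrow> nat set" where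
  "extended_north_set m r P Q i =
     north_set m r P Q i \<union> I_plus m r P Q i \<union> I_minus m r P Q i"

end

theory Submission
  imports Defs
begin

text \<open>
  Let \<open>hits \<A> Z\<close> be the number of members of \<open>\<A>\<close> that meet \<open>Z\<close>. By Hall's theorem the rank of
  \<open>X\<close> is the minimum of \<open>hits \<A> Y + card (X - Y)\<close> over \<open>Y \<subseteq> X\<close>, and if the restriction to \<open>X\<close> has
  no isthmuses, the minimum is attained at \<open>Y = X\<close> only, so that \<open>hits \<A> X\<close> is the rank of \<open>X\<close>. An
  element \<open>x\<close> can be added to a member \<open>A\<close> of a presentation on \<open>S\<close> if it is an isthmus of the
  restriction to \<open>S - A\<close>. Hence a presentation is maximal iff the restrictions to all complements
  \<open>S - A\<close> have no isthmuses, and then the numbers \<open>hits \<A> (S - A)\<close> are determined by the matroid;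
  inverting these counts over inclusion shows that the maximal presentation is unique.

  For a lattice path matroid, avoiding an element of \<open>I\<^sub>i\<^sup>+\<close> or \<open>I\<^sub>i\<^sup>-\<close> in addition to \<open>N\<^sub>i\<close> lowers the
  rank, because a run of consecutive endpoints is exhausted; and outside \<open>N'\<^sub>i\<close> there are no
  isthmuses, because the gap at the end of a maximal run leaves room to move the endpoints.
\<close>

section \<open>Hall's theorem for set systems\<close>

text \<open>Induction on the size of \<open>X\<close>. If some nonempty proper subset
  \<open>Z\<close> is tight, \<open>Z\<close> and \<open>X - Z\<close> are matched separately, with
  disjoint sets of indices. Otherwise each such subset has an index to spare, so one element can be
  matched arbitrarily.\<close>

lemma hall:
  fixes A :: "'i \<Rightarrow> 'a set"
  assumes "finite X" "finite I" "\<And>Z. Z \<subseteq> X \<Longrightarrow> card Z \<le> card {i \<in> I. A i \<inter> Z \<noteq> {}}"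
  shows "\<exists>\<phi>. inj_on \<phi> X \<and> (\<forall>x\<in>X. \<phi> x \<in> I \<and> x \<in> A (\<phi> x))"
  using assms
proof (induction "card X" arbitrary: X I rule: less_induct)
  case less
  let ?N = "\<lambda>I Z. {i \<in> I. A i \<inter> Z \<noteq> {}}"
  note finX = less.prems(1) and finI = less.prems(2) and H = less.prems(3)
  show ?case
  proof (cases "X = {}")
    case False
    show ?thesis
    proof (cases "\<exists>Z. Z \<subset> X \<and> Z \<noteq> {} \<and> card (?N I Z) \<le> card Z")
      case True
      then obtain Z where Z: "Z \<subset> X" "Z \<noteq> {}" and tight: "card (?N I Z) \<le> card Z" by blast
      have finZ: "finite Z" using Z finX finite_subset by blast
      have "card Z < card X" using Z finX psubset_card_mono by blast
      moreover have "card W \<le> card (?N (?N I Z) W)" if "W \<subseteq> Z" for W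
      proof -
        have "?N (?N I Z) W = ?N I W" using that by blast
        then show ?thesis using H[of W] that Z by auto
      qed
      ultimately obtain \<phi>1 where \<phi>1: "inj_on \<phi>1 Z" "\<forall>x\<in>Z. \<phi>1 x \<in> ?N I Z \<and> x \<in> A (\<phi>1 x)"
        using less.hyps[of Z "?N I Z"] finZ finI by auto
      have "card (X - Z) < card X" using Z finX by (intro psubset_card_mono) auto
      \<comment> \<open>Hall's condition for \<open>W \<union> Z\<close> supplies enough indices,
        and by tightness at most \<open>card Z\<close> of them meet \<open>Z\<close>; the others
        serve \<open>W\<close>.\<close>
      moreover have "card W \<le> card (?N (I - ?N I Z) W)" if "W \<subseteq> X - Z" for W
      proof -
        have finW: "finite W" using that finX finite_subset by blast
        have "card W + card Z = card (W \<union> Z)"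
          using that finW finZ by (subst card_Un_disjoint) auto
        also have "\<dots> \<le> card (?N I (W \<union> Z))" using that Z by (intro H) auto
        also have "?N I (W \<union> Z) = ?N (I - ?N I Z) W \<union> ?N I Z" by blast
        also have "card \<dots> \<le> card (?N (I - ?N I Z) W) + card (?N I Z)" by (rule card_Un_le)
        finally show ?thesis using tight by simp
      qed
      ultimately obtain \<phi>2
        where \<phi>2: "inj_on \<phi>2 (X - Z)" "\<forall>x\<in>X - Z. \<phi>2 x \<in> I - ?N I Z \<and> x \<in> A (\<phi>2 x)"
        using less.hyps[of "X - Z" "I - ?N I Z"] finX finI by auto
      let ?\<phi> = "\<lambda>x. if x \<in> Z then \<phi>1 x else \<phi>2 x"
      have "inj_on ?\<phi> X"
      proof (rule inj_onI)
        fix x y assume xy: "x \<in> X" "y \<in> X" "?\<phi> x = ?\<phi> y"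
        show "x = y"
        proof (cases "x \<in> Z \<longleftrightarrow> y \<in> Z")
          case True
          then show ?thesis using xy \<phi>1(1) \<phi>2(1) by (auto simp: inj_on_def split: if_splits)
        next
          case False
          then have "?\<phi> x \<in> ?N I Z \<longleftrightarrow> ?\<phi> y \<notin> ?N I Z"
            using xy(1,2) \<phi>1(2) \<phi>2(2) by simp
          then show ?thesis unfolding xy(3) by blast
        qed
      qed
      moreover have "\<forall>x\<in>X. ?\<phi> x \<in> I \<and> x \<in> A (?\<phi> x)" using \<phi>1(2) \<phi>2(2) by auto
      ultimately show ?thesis by blast
    next
      case slack: False
      obtain x where x: "x \<in> X" using False by blast
      have "card {x} \<le> card (?N I {x})" using x by (intro H) auto
      then have "?N I {x} \<noteq> {}" by (intro notI) (simp only: card.empty, simp)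
      then obtain i where i: "i \<in> I" "x \<in> A i" by auto
      have "card (X - {x}) < card X" using x finX by (intro psubset_card_mono) auto
      \<comment> \<open>Removing \<open>i\<close> loses at most one index, which the strict
        inequality for nonempty \<open>W\<close> can afford.\<close>
      moreover have "card W \<le> card (?N (I - {i}) W)" if "W \<subseteq> X - {x}" for W
      proof (cases "W = {}")
        case False
        then have "card W < card (?N I W)" using slack that x by (auto simp: not_le)
        moreover have "?N I W \<subseteq> insert i (?N (I - {i}) W)" by blast
        then have "card (?N I W) \<le> Suc (card (?N (I - {i}) W))"
          using card_mono[of "insert i (?N (I - {i}) W)" "?N I W"] finI
          by (auto simp: card_insert_if split: if_splits)
        ultimately show ?thesis by simp
      qed simp
      ultimately obtain \<phi>
        where \<phi>: "inj_on \<phi> (X - {x})" "\<forall>y\<in>X - {x}. \<phi> y \<in> I - {i} \<and> y \<in> A (\<phi> y)"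
        using less.hyps[of "X - {x}" "I - {i}"] finX finI by auto
      have "inj_on (\<phi>(x := i)) X"
        using \<phi> by (auto simp: inj_on_def)
      moreover have "\<forall>y\<in>X. (\<phi>(x := i)) y \<in> I \<and> y \<in> A ((\<phi>(x := i)) y)" using \<phi>(2) i by auto
      ultimately show ?thesis by blast
    qed
  qed simp
qed

section \<open>Counting the members that meet a set\<close>

definition hits :: "'a set multiset \<Rightarrow> 'a set \<Rightarrow> nat" where
  "hits \<A> Z = size {#A \<in># \<A>. A \<inter> Z \<noteq> {}#}"

lemma hits_empty [simp]: "hits {#} Z = 0"
  by (simp add: hits_def)

lemma hits_add_mset [simp]: "hits (add_mset A \<A>) Z = (if A \<inter> Z \<noteq> {} then 1 else 0) + hits \<A> Z"
  by (simp add: hits_def)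

lemma hits_mono: "Y \<subseteq> Z \<Longrightarrow> hits \<A> Y \<le> hits \<A> Z"
  by (induction \<A>) auto

lemma hits_le_size: "hits \<A> Z \<le> size \<A>"
  by (simp add: hits_def size_filter_mset_lesseq)

lemma hits_submodular: "hits \<A> (Y \<union> Z) + hits \<A> (Y \<inter> Z) \<le> hits \<A> Y + hits \<A> Z"
  by (induction \<A>) auto

lemma hits_mset: "hits (mset As) Z = card {i \<in> {..<length As}. As ! i \<inter> Z \<noteq> {}}"
  by (simp add: hits_def length_filter_conv_card flip: mset_filter)

lemma hits_image_mset:
  "finite I \<Longrightarrow> hits (image_mset A (mset_set I)) Z = card {i \<in> I. A i \<inter> Z \<noteq> {}}"
  by (simp add: hits_def filter_mset_image_mset)

text \<open>Hall's theorem with list positions as indices. It replaces indexings and matchings by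
  inequalities about \<open>hits\<close>, which can be combined by submodularity.\<close>

lemma partial_transversal_iff:
  "partial_transversal \<A> X \<longleftrightarrow> finite X \<and> (\<forall>Z\<subseteq>X. card Z \<le> hits \<A> Z)"
proof
  assume "partial_transversal \<A> X"
  then obtain As \<phi> where As: "mset As = \<A>" and inj: "inj_on \<phi> X"
    and \<phi>: "\<forall>x\<in>X. \<phi> x < length As \<and> x \<in> As ! \<phi> x"
    unfolding partial_transversal_def by blast
  have "\<phi> ` X \<subseteq> {..<length As}" using \<phi> by blast
  then have "finite X" using inj finite_imageD finite_subset by blast
  moreover have "card Z \<le> hits \<A> Z" if "Z \<subseteq> X" for Z
  proof -
    have "card Z = card (\<phi> ` Z)" using inj that by (metis card_image inj_on_subset)
    also have "\<dots> \<le> card {i \<in> {..<length As}. As ! i \<inter> Z \<noteq> {}}"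
      using \<phi> that by (intro card_mono) auto
    finally show ?thesis using As hits_mset by metis
  qed
  ultimately show "finite X \<and> (\<forall>Z\<subseteq>X. card Z \<le> hits \<A> Z)" by blast
next
  assume asm: "finite X \<and> (\<forall>Z\<subseteq>X. card Z \<le> hits \<A> Z)"
  obtain As where As: "mset As = \<A>" using ex_mset by blast
  have "\<exists>\<phi>. inj_on \<phi> X \<and> (\<forall>x\<in>X. \<phi> x \<in> {..<length As} \<and> x \<in> As ! \<phi> x)"
    using asm by (intro hall) (simp_all add: hits_mset[symmetric] As del: lessThan_iff)
  then show "partial_transversal \<A> X"
    unfolding partial_transversal_def using As by auto
qed

lemma partial_transversal_empty [simp]: "partial_transversal \<A> {}"
  by (simp add: partial_transversal_iff)

lemma partial_transversal_subset:
  "partial_transversal \<A> X \<Longrightarrow> Y \<subseteq> X \<Longrightarrow> partial_transversal \<A> Y"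
  by (auto simp: partial_transversal_iff finite_subset)

lemma card_partial_transversal_le: "partial_transversal \<A> X \<Longrightarrow> card X \<le> size \<A>"
  using hits_le_size le_trans unfolding partial_transversal_iff by blast

lemma partial_transversal_subset_Union:
  assumes "partial_transversal \<A> X" "\<forall>A\<in>#\<A>. A \<subseteq> S"
  shows "X \<subseteq> S"
  using assms unfolding partial_transversal_def by fastforce

lemma partial_transversal_extends:
  assumes "partial_transversal \<A> X"
  shows "\<exists>B\<in>maximal_partial_transversals \<A>. X \<subseteq> B"
proof -
  let ?P = "\<lambda>B. partial_transversal \<A> B \<and> X \<subseteq> B"
  have "\<exists>B. ?P B \<and> (\<forall>C. ?P C \<longrightarrow> card C \<le> card B)"
    using assms card_partial_transversal_le by (intro ex_has_greatest_nat[where b = "Suc (size \<A>)"])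
      (auto simp: less_Suc_eq_le)
  then obtain B where B: "?P B" "\<And>C. ?P C \<Longrightarrow> card C \<le> card B" by blast
  have "C = B" if "partial_transversal \<A> C" "B \<subseteq> C" for C
  proof -
    have "card C \<le> card B" using that B by blast
    moreover have "finite C" using that by (simp add: partial_transversal_iff)
    ultimately show ?thesis using that card_seteq by blast
  qed
  then show ?thesis using B(1) by (auto simp: maximal_partial_transversals_def)
qed

text \<open>The partial transversals are exactly the subsets of the bases, so the matroid determines
  them.\<close>

lemma partial_transversal_eq_if_bases_eq:
  assumes "maximal_partial_transversals \<A> = maximal_partial_transversals \<B>"
  shows "partial_transversal \<A> = partial_transversal \<B>"
proof -
  have "partial_transversal \<C> X \<longleftrightarrow> (\<exists>B\<in>maximal_partial_transversals \<C>. X \<subseteq> B)"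
    for \<C> :: "'a set multiset" and X
    using partial_transversal_extends partial_transversal_subset
    by (auto simp: maximal_partial_transversals_def)
  then show ?thesis using assms by (intro ext) simp
qed

section \<open>The rank function\<close>

definition rk :: "'a set multiset \<Rightarrow> 'a set \<Rightarrow> nat" where
  "rk \<A> X = Max {card B | B. B \<subseteq> X \<and> partial_transversal \<A> B}"

lemma rk_cong: "partial_transversal \<A> = partial_transversal \<B> \<Longrightarrow> rk \<A> = rk \<B>"
  by (simp add: rk_def fun_eq_iff)

lemma finite_rk_set: "finite {card B | B. B \<subseteq> X \<and> partial_transversal \<A> B}"
  by (rule finite_subset[of _ "{..size \<A>}"]) (auto intro: card_partial_transversal_le)

lemma card_le_rk: "B \<subseteq> X \<Longrightarrow> partial_transversal \<A> B \<Longrightarrow> card B \<le> rk \<A> X"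
  unfolding rk_def by (rule Max_ge[OF finite_rk_set]) blast

lemma rk_witness: "\<exists>B. B \<subseteq> X \<and> partial_transversal \<A> B \<and> card B = rk \<A> X"
proof -
  have "{card B | B. B \<subseteq> X \<and> partial_transversal \<A> B} \<noteq> {}"
    using partial_transversal_empty by blast
  from Max_in[OF finite_rk_set this]
  obtain B where "rk \<A> X = card B" "B \<subseteq> X" "partial_transversal \<A> B"
    unfolding rk_def[symmetric] by blast
  then show ?thesis by metis
qed

lemma rk_mono: "X \<subseteq> Y \<Longrightarrow> rk \<A> X \<le> rk \<A> Y"
  by (metis card_le_rk order.trans rk_witness)

text \<open>The part of a partial transversal inside \<open>Y\<close> is bounded by the members
  meeting \<open>Y\<close>, the rest by \<open>card (X - Y)\<close>. \<open>Y\<close> need not lie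
  in \<open>X\<close>, so later rank bounds can use half-lines.\<close>

lemma rk_le_hits:
  assumes "finite X"
  shows "rk \<A> X \<le> hits \<A> Y + card (X - Y)"
proof -
  obtain B where B: "B \<subseteq> X" "partial_transversal \<A> B" "card B = rk \<A> X"
    using rk_witness[of X \<A>] by blast
  have "finite B" using B assms finite_subset by blast
  then have "card B = card (B \<inter> Y) + card (B - Y)" by (metis card_Int_Diff)
  also have "card (B \<inter> Y) \<le> hits \<A> (B \<inter> Y)" using B(2) by (simp add: partial_transversal_iff)
  also have "\<dots> \<le> hits \<A> Y" by (rule hits_mono) blast
  also have "card (B - Y) \<le> card (X - Y)" using B(1) assms by (intro card_mono) auto
  finally show ?thesis using B(3) by simp
qed

text \<open>Sets \<open>T \<subseteq> B\<close> with \<open>hits \<A> T = card T\<close> are closed under unions by submodularity; each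
  \<open>e \<in> X - B\<close> yields one, namely the rest of its fundamental circuit.\<close>

lemma rk_eq_hits:
  assumes "finite X"
  shows "\<exists>Y\<subseteq>X. rk \<A> X = hits \<A> Y + card (X - Y)"
proof -
  obtain B where B: "B \<subseteq> X" "partial_transversal \<A> B" "card B = rk \<A> X"
    using rk_witness[of X \<A>] by blast
  have finB: "finite B" and hall_B: "\<And>Z. Z \<subseteq> B \<Longrightarrow> card Z \<le> hits \<A> Z"
    using B(2) by (auto simp: partial_transversal_iff)
  have single: "\<exists>T\<subseteq>B. hits \<A> (insert e T) \<le> card T" if e: "e \<in> X - B" for e
  proof -
    have "\<not> partial_transversal \<A> (insert e B)"
      using card_le_rk[of "insert e B" X \<A>] e B finB by auto
    then obtain Z where Z: "Z \<subseteq> insert e B" "hits \<A> Z < card Z"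
      using finB by (auto simp: partial_transversal_iff not_le)
    then have "e \<in> Z" using hall_B[of Z] by (metis leD subset_insert)
    moreover have "finite Z" using Z finB finite_subset by blast
    ultimately have "hits \<A> (insert e (Z - {e})) \<le> card (Z - {e})"
      using Z by (simp add: insert_absorb)
    then show ?thesis using Z by (intro exI[of _ "Z - {e}"]) auto
  qed
  have "\<exists>T\<subseteq>B. hits \<A> (T \<union> F) \<le> card T" if "finite F" "F \<subseteq> X - B" for F
    using that
  proof (induction F)
    case empty
    have "hits \<A> {} = 0" by (simp add: hits_def)
    then show ?case by (intro exI[of _ "{}"]) simp
  next
    case (insert e F)
    then obtain T1 where T1: "T1 \<subseteq> B" "hits \<A> (T1 \<union> F) \<le> card T1" by auto
    obtain T2 where T2: "T2 \<subseteq> B" "hits \<A> (insert e T2) \<le> card T2"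
      using single[of e] insert.prems by blast
    let ?Y = "T1 \<union> F" and ?Z = "insert e T2"
    have "hits \<A> (?Y \<union> ?Z) + hits \<A> (?Y \<inter> ?Z) \<le> card T1 + card T2"
      using hits_submodular[of \<A> ?Y ?Z] T1 T2 by linarith
    moreover have "card (T1 \<inter> T2) \<le> hits \<A> (T1 \<inter> T2)" using T1 by (intro hall_B) auto
    moreover have "hits \<A> (T1 \<inter> T2) \<le> hits \<A> (?Y \<inter> ?Z)" by (rule hits_mono) auto
    moreover have "card T1 + card T2 = card (T1 \<union> T2) + card (T1 \<inter> T2)"
      using T1 T2 finB by (intro card_Un_Int) (auto intro: finite_subset)
    ultimately have "hits \<A> (?Y \<union> ?Z) \<le> card (T1 \<union> T2)" by linarith
    moreover have "?Y \<union> ?Z = (T1 \<union> T2) \<union> insert e F" by blast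
    ultimately show ?case using T1 T2 by (intro exI[of _ "T1 \<union> T2"]) auto
  qed
  \<comment> \<open>With all of \<open>X - B\<close> absorbed, \<open>T \<union> (X - B)\<close>
    attains the bound: at most \<open>card T\<close> members meet it, and only \<open>B - T\<close>
    stays outside.\<close>
  from this[of "X - B"] obtain T where T: "T \<subseteq> B" "hits \<A> (T \<union> (X - B)) \<le> card T"
    using assms by auto
  let ?Y = "T \<union> (X - B)"
  have "X - ?Y = B - T" using T B by blast
  moreover have "card B = card T + card (B - T)"
    using T finB by (metis card_Diff_subset card_mono finite_subset le_add_diff_inverse)
  ultimately have "hits \<A> ?Y + card (X - ?Y) \<le> rk \<A> X" using T B(3) by simp
  then show ?thesis using rk_le_hits[OF assms, of \<A> ?Y] T B by (intro exI[of _ ?Y]) auto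
qed

text \<open>These sets are the unions of circuits: the restriction to \<open>X\<close> has no
  isthmus.\<close>

definition cyclic :: "'a set multiset \<Rightarrow> 'a set \<Rightarrow> bool" where
  "cyclic \<A> X \<longleftrightarrow> (\<forall>x\<in>X. rk \<A> (X - {x}) = rk \<A> X)"

text \<open>If a minimizing \<open>Y\<close> missed some \<open>x\<close> in \<open>X\<close>,
  deleting \<open>x\<close> would lower the bound given by \<open>Y\<close>, and with it the rank.
  Thus \<open>hits\<close> on a cyclic set can be read off from the matroid.\<close>

lemma rk_cyclic:
  assumes "finite X" "cyclic \<A> X"
  shows "rk \<A> X = hits \<A> X"
proof -
  obtain Y where Y: "Y \<subseteq> X" "rk \<A> X = hits \<A> Y + card (X - Y)"
    using rk_eq_hits[OF assms(1)] by blast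
  have "x \<in> Y" if x: "x \<in> X" for x
  proof (rule ccontr)
    assume "x \<notin> Y"
    then have "card (X - {x} - Y) < card (X - Y)"
      using x assms(1) by (intro psubset_card_mono) auto
    then have "rk \<A> (X - {x}) < rk \<A> X"
      using rk_le_hits[of "X - {x}" \<A> Y] assms(1) Y by simp
    then show False using assms(2) x by (auto simp: cyclic_def)
  qed
  then have "Y = X" using Y(1) by blast
  then show ?thesis using Y(2) by simp
qed

text \<open>The hypotheses on \<open>Z\<close> put \<open>x\<close> on a circuit inside
  \<open>Z\<close>. If \<open>Y\<close> attains the rank of \<open>X - {x}\<close>, then by
  submodularity \<open>Y \<union> Z\<close> gives a bound for \<open>X\<close> that is no
  larger.\<close>

lemma rk_remove_dependent:
  assumes "finite X" "Z \<subseteq> X" "x \<in> Z" "hits \<A> Z < card Z" "partial_transversal \<A> (Z - {x})"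
  shows "rk \<A> (X - {x}) = rk \<A> X"
proof (rule antisym)
  show "rk \<A> (X - {x}) \<le> rk \<A> X" by (rule rk_mono) blast
  obtain Y where Y: "Y \<subseteq> X - {x}" "rk \<A> (X - {x}) = hits \<A> Y + card (X - {x} - Y)"
    using rk_eq_hits[of "X - {x}"] assms(1) by blast
  have fin: "finite Z" "finite Y" using assms(1,2) Y(1) finite_subset by blast+
  have "card (Y \<inter> Z) \<le> hits \<A> (Y \<inter> Z)"
    using assms(5) Y(1) by (auto simp: partial_transversal_iff)
  moreover have "hits \<A> (Y \<union> Z) + hits \<A> (Y \<inter> Z) \<le> hits \<A> Y + hits \<A> Z"
    by (rule hits_submodular)
  moreover have "card Z = card (Y \<inter> Z) + card (Z - Y)"
    using fin by (metis Int_commute card_Int_Diff)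
  moreover have "rk \<A> X \<le> hits \<A> (Y \<union> Z) + card (X - (Y \<union> Z))"
    by (rule rk_le_hits[OF assms(1)])
  moreover have "card (X - Y) = card (Z - Y) + card (X - (Y \<union> Z))"
  proof -
    have "X - Y = (Z - Y) \<union> (X - (Y \<union> Z))" using assms(2) by blast
    then show ?thesis using assms(1) fin by (simp, subst card_Un_disjoint) auto
  qed
  moreover have "card (X - Y) = Suc (card (X - {x} - Y))"
  proof -
    have "X - Y = insert x (X - {x} - Y)" using assms(2,3) Y(1) by blast
    then show ?thesis using assms(1) by (metis Diff_iff card_insert_disjoint finite_Diff singletonI)
  qed
  ultimately show "rk \<A> X \<le> rk \<A> (X - {x})" using assms(4) Y(2) by linarith
qed

section \<open>Maximal presentations\<close>

text \<open>Used in contrapositive form: if \<open>hits\<close> grows on \<open>Z\<close>, some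
  related pair has its first set avoiding \<open>Z\<close> and its second set meeting it.\<close>

lemma hits_rel_mset:
  assumes "rel_mset R \<A> \<B>" "\<And>A B. R A B \<Longrightarrow> A \<inter> Z = {} \<Longrightarrow> B \<inter> Z = {}"
  shows "hits \<B> Z \<le> hits \<A> Z"
  using assms
proof (induction rule: rel_mset_induct)
  case (add R A B \<A> \<B>)
  then show ?case using add.prems[of A B] by auto
qed simp

lemma rel_mset_right: "rel_mset R \<A> \<B> \<Longrightarrow> B \<in># \<B> \<Longrightarrow> \<exists>A\<in>#\<A>. R A B"
  by (induction rule: rel_mset_induct) auto

lemma rel_mset_image_mset:
  assumes "finite I" "\<And>i. i \<in> I \<Longrightarrow> R (A i) (B i)"
  shows "rel_mset R (image_mset A (mset_set I)) (image_mset B (mset_set I))"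
  using assms by (induction I) (auto intro: rel_mset_Plus rel_mset_Zero)

lemma hits_mono_rel_mset: "rel_mset (\<subseteq>) \<A> \<B> \<Longrightarrow> hits \<A> Z \<le> hits \<B> Z"
  by (induction "(\<subseteq>) :: 'a set \<Rightarrow> 'a set \<Rightarrow> bool" \<A> \<B> rule: rel_mset_induct) auto

lemma partial_transversal_rel_mset:
  assumes "rel_mset (\<subseteq>) \<A> \<B>" "partial_transversal \<A> X"
  shows "partial_transversal \<B> X"
  using assms hits_mono_rel_mset[OF assms(1)] le_trans unfolding partial_transversal_iff by blast

text \<open>A circuit that is destroyed by enlarging \<open>A\<close> to \<open>B\<close> avoids \<open>A\<close> and meets \<open>B\<close> in some
  \<open>x\<close>; that \<open>x\<close> is then not an isthmus of the restriction to \<open>S - A\<close>.\<close>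

lemma partial_transversal_enlarge:
  assumes "finite S"
    and rel: "rel_mset (\<lambda>A B. A \<subseteq> B \<and> B \<subseteq> S \<and>
      (\<forall>x\<in>B - A. rk \<A> (S - A - {x}) \<noteq> rk \<A> (S - A))) \<A> \<B>"
      (is "rel_mset ?R \<A> \<B>")
  shows "partial_transversal \<B> = partial_transversal \<A>"
proof (intro ext iffI)
  fix X
  show "partial_transversal \<B> X" if "partial_transversal \<A> X"
    using that multiset.rel_mono_strong[OF rel] by (auto intro: partial_transversal_rel_mset)
  assume X: "partial_transversal \<B> X"
  have "\<forall>B\<in>#\<B>. B \<subseteq> S"
    using rel_mset_right[OF rel] by blast
  then have "X \<subseteq> S" using partial_transversal_subset_Union[OF X] by blast
  show "partial_transversal \<A> X"
  proof (rule ccontr)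
    assume "\<not> partial_transversal \<A> X"
    then obtain Z' where "Z' \<subseteq> X \<and> hits \<A> Z' < card Z'"
      using X by (auto simp: partial_transversal_iff not_le)
    \<comment> \<open>A violator of Hall's condition of least size is a circuit.\<close>
    then obtain Z where Z: "Z \<subseteq> X" "hits \<A> Z < card Z"
      and least: "\<And>W. W \<subseteq> X \<Longrightarrow> hits \<A> W < card W \<Longrightarrow> card Z \<le> card W"
      using ex_has_least_nat[of "\<lambda>Z. Z \<subseteq> X \<and> hits \<A> Z < card Z" Z' card] by auto
    have fin: "finite X" and "card Z \<le> hits \<B> Z" using X Z by (auto simp: partial_transversal_iff)
    then have "\<not> hits \<B> Z \<le> hits \<A> Z" using Z by linarith
    then obtain A B where AB: "?R A B" "A \<inter> Z = {}" "B \<inter> Z \<noteq> {}"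
      using hits_rel_mset[OF rel, of Z] by blast
    then obtain x where x: "x \<in> B" "x \<in> Z" by blast
    have finZ: "finite Z" using Z fin finite_subset by blast
    have "card W \<le> hits \<A> W" if "W \<subseteq> Z - {x}" for W
    proof (rule ccontr)
      assume "\<not> card W \<le> hits \<A> W"
      then have "card Z \<le> card W" using that Z by (intro least) auto
      moreover have "card W < card Z" using that x finZ by (intro psubset_card_mono) auto
      ultimately show False by simp
    qed
    then have "partial_transversal \<A> (Z - {x})" using finZ by (simp add: partial_transversal_iff)
    then have "rk \<A> (S - A - {x}) = rk \<A> (S - A)"
      using assms(1) AB Z x \<open>X \<subseteq> S\<close> by (intro rk_remove_dependent[of _ Z]) auto
    then show False using AB x by auto
  qed
qed

text \<open>Isolates one member that grows strictly, while the remaining members still compare;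
  \<open>hits\<close> then splits into this member and the rest.\<close>

lemma rel_mset_subset_cases:
  assumes "rel_mset (\<subseteq>) \<A> \<B>"
  shows "\<A> = \<B> \<or>
    (\<exists>A B \<A>' \<B>'. \<A> = add_mset A \<A>' \<and> \<B> = add_mset B \<B>' \<and> A \<subset> B \<and> rel_mset (\<subseteq>) \<A>' \<B>')"
  using assms
proof (induction "(\<subseteq>) :: 'a set \<Rightarrow> 'a set \<Rightarrow> bool" \<A> \<B> rule: rel_mset_induct)
  case (add A B \<A> \<B>)
  show ?case
  proof (cases "A = B")
    case True
    from add(3) show ?thesis
    proof
      assume "\<exists>A' B' \<A>' \<B>'. \<A> = add_mset A' \<A>' \<and> \<B> = add_mset B' \<B>' \<and> A' \<subset> B' \<and>
        rel_mset (\<subseteq>) \<A>' \<B>'"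
      then obtain A' B' \<A>' \<B>' where *: "\<A> = add_mset A' \<A>'" "\<B> = add_mset B' \<B>'" "A' \<subset> B'"
        "rel_mset (\<subseteq>) \<A>' \<B>'" by blast
      have "rel_mset (\<subseteq>) (add_mset A \<A>') (add_mset B \<B>')"
        using *(4) True by (simp add: rel_mset_Plus)
      moreover have "add_mset A \<A> = add_mset A' (add_mset A \<A>')"
        "add_mset B \<B> = add_mset B' (add_mset B \<B>')" using * by auto
      ultimately show ?thesis using *(3) by blast
    qed (use True in simp)
  next
    case False
    then show ?thesis using add by blast
  qed
qed simp

section \<open>Comparing presentations of the same matroid\<close>

lemma presentations_same_partial_transversals:
  "presentation M \<A> \<Longrightarrow> presentation M \<B> \<Longrightarrow> partial_transversal \<A> = partial_transversal \<B>"
  by (rule partial_transversal_eq_if_bases_eq) (simp add: presentation_def)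

lemma presentations_hits_cyclic:
  assumes "presentation M \<A>" "presentation M \<B>" "finite X" "cyclic \<A> X"
  shows "hits \<A> X = hits \<B> X"
proof -
  have "rk \<A> = rk \<B>"
    by (intro rk_cong presentations_same_partial_transversals[OF assms(1,2)])
  then show ?thesis using assms(3,4) rk_cyclic by (metis cyclic_def)
qed

text \<open>An isthmus of the restriction to \<open>ground M - A\<close> could be added to
  \<open>A\<close>. Conversely, growth of \<open>A\<close> would let one more member meet
  \<open>ground M - A\<close>, but on a cyclic set this number is fixed by the matroid.\<close>

lemma maximal_presentation_iff:
  assumes "finite (ground M)" "presentation M \<A>"
  shows "maximal_presentation M \<A> \<longleftrightarrow> (\<forall>A\<in>#\<A>. cyclic \<A> (ground M - A))"
proof
  let ?S = "ground M"
  assume max: "maximal_presentation M \<A>"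
  show "\<forall>A\<in>#\<A>. cyclic \<A> (?S - A)"
  proof (rule ccontr)
    assume "\<not> (\<forall>A\<in>#\<A>. cyclic \<A> (?S - A))"
    then obtain A x where A: "A \<in># \<A>" and x: "x \<in> ?S - A"
      and isth: "rk \<A> (?S - A - {x}) \<noteq> rk \<A> (?S - A)"
      by (auto simp: cyclic_def)
    from A obtain \<C> where \<C>: "\<A> = add_mset A \<C>" by (metis mset_add)
    let ?\<B> = "add_mset (insert x A) \<C>"
    have sub: "\<forall>C\<in>#\<A>. C \<subseteq> ?S" using assms(2) by (simp add: presentation_def)
    let ?R = "\<lambda>A B. A \<subseteq> B \<and> B \<subseteq> ?S \<and> (\<forall>x\<in>B - A. rk \<A> (?S - A - {x}) \<noteq> rk \<A> (?S - A))"
    have "rel_mset ?R \<C> \<C>" using sub \<C> by (intro multiset.rel_refl_strong) auto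
    moreover have "?R A (insert x A)" using sub x isth A by auto
    ultimately have rel: "rel_mset ?R \<A> ?\<B>"
      unfolding \<C> by (intro rel_mset_Plus) auto
    have "partial_transversal ?\<B> = partial_transversal \<A>"
      by (rule partial_transversal_enlarge[OF assms(1) rel])
    then have "maximal_partial_transversals ?\<B> = maximal_partial_transversals \<A>"
      by (simp only: maximal_partial_transversals_def)
    then have "presentation M ?\<B>"
      using assms(2) sub x \<C> unfolding presentation_def by (metis DiffD1 insert_subset
          set_mset_add_mset_insert insert_iff size_add_mset)
    moreover have "rel_mset (\<subseteq>) \<A> ?\<B>" using multiset.rel_mono_strong[OF rel] by auto
    ultimately have "?\<B> = \<A>" using max by (auto simp: maximal_presentation_def)
    then show False using x \<C> by auto
  qed
next
  let ?S = "ground M"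
  assume cyc: "\<forall>A\<in>#\<A>. cyclic \<A> (?S - A)"
  have "\<B> = \<A>" if \<B>: "presentation M \<B>" and rel: "rel_mset (\<subseteq>) \<A> \<B>" for \<B>
  proof (rule ccontr)
    assume "\<B> \<noteq> \<A>"
    then obtain A B \<A>' \<B>' where *: "\<A> = add_mset A \<A>'" "\<B> = add_mset B \<B>'" "A \<subset> B"
      "rel_mset (\<subseteq>) \<A>' \<B>'"
      using rel_mset_subset_cases[OF rel] by blast
    have "B \<subseteq> ?S" using \<B> * by (auto simp: presentation_def)
    have "hits \<A>' (?S - A) \<le> hits \<B>' (?S - A)" using *(4) by (rule hits_mono_rel_mset)
    moreover have "A \<inter> (?S - A) = {}" "B \<inter> (?S - A) \<noteq> {}" using * \<open>B \<subseteq> ?S\<close> by auto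
    ultimately have "hits \<A> (?S - A) < hits \<B> (?S - A)" using * by simp
    moreover have "hits \<A> (?S - A) = hits \<B> (?S - A)"
      using presentations_hits_cyclic[OF assms(2) \<B>, of "?S - A"] cyc * assms(1) by auto
    ultimately show False by simp
  qed
  then show "maximal_presentation M \<A>" using assms(2) by (simp add: maximal_presentation_def)
qed

text \<open>Inversion over inclusion: the members properly contained in \<open>A\<close> are smaller
  sets, whose multiplicities agree by induction, so the multiplicities of \<open>A\<close> agree
  too. Sets in neither multiset have count zero in both.\<close>

lemma multiset_eq_if_subset_counts_eq:
  fixes \<A> \<B> :: "'a set multiset"
  assumes fin: "\<And>A. A \<in># \<A> + \<B> \<Longrightarrow> finite A"
    and eq: "\<And>A. A \<in># \<A> + \<B> \<Longrightarrow> size {#C \<in># \<A>. C \<subseteq> A#} = size {#C \<in># \<B>. C \<subseteq> A#}"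
  shows "\<A> = \<B>"
proof (rule multiset_eqI)
  fix A
  show "count \<A> A = count \<B> A"
  proof (induction "card A" arbitrary: A rule: less_induct)
    case less
    show ?case
    proof (cases "A \<in># \<A> + \<B>")
      case True
      have "{#C \<in># \<A>. C \<subset> A#} = {#C \<in># \<B>. C \<subset> A#}"
        using less psubset_card_mono[OF fin[OF True]] by (intro multiset_eqI) simp
      moreover have "size {#C \<in># \<C>. C \<subseteq> A#} = count \<C> A + size {#C \<in># \<C>. C \<subset> A#}"
        for \<C> :: "'a set multiset"
        by (induction \<C>) auto
      ultimately show ?thesis using eq[OF True] by simp
    qed (simp add: not_in_iff)
  qed
qed

lemma maximal_presentation_unique:
  assumes "finite (ground M)" "maximal_presentation M \<A>" "maximal_presentation M \<B>"
  shows "\<A> = \<B>"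
proof -
  let ?S = "ground M"
  have pres: "presentation M \<A>" "presentation M \<B>"
    using assms(2,3) by (auto simp: maximal_presentation_def)
  have sub: "C \<subseteq> ?S" if "C \<in># \<A> + \<B>" for C
    using that pres by (auto simp: presentation_def)
  show ?thesis
  proof (rule multiset_eq_if_subset_counts_eq)
    show "finite A" if "A \<in># \<A> + \<B>" for A
      using sub[OF that] assms(1) finite_subset by blast
    fix A assume A: "A \<in># \<A> + \<B>"
    \<comment> \<open>\<open>A\<close> may come from either presentation; cyclicity with respect to
      that one suffices.\<close>
    have "cyclic \<A> (?S - A) \<or> cyclic \<B> (?S - A)"
      using A assms maximal_presentation_iff pres by auto
    then have "hits \<A> (?S - A) = hits \<B> (?S - A)"
      using presentations_hits_cyclic[OF pres, of "?S - A"]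
        presentations_hits_cyclic[OF pres(2,1), of "?S - A"] assms(1) by auto
    \<comment> \<open>The members inside \<open>A\<close> are exactly those that miss
      \<open>?S - A\<close>.\<close>
    moreover have "size {#C \<in># \<C>. C \<subseteq> A#} + hits \<C> (?S - A) = size \<C>"
      if "\<forall>C\<in>#\<C>. C \<subseteq> ?S" for \<C>
      using that by (induction \<C>) auto
    moreover have "size \<A> = size \<B>" using pres by (simp add: presentation_def)
    ultimately show "size {#C \<in># \<A>. C \<subseteq> A#} = size {#C \<in># \<B>. C \<subseteq> A#}"
      using sub by (metis add_right_cancel union_iff)
  qed
qed

section \<open>Systems of intervals with increasing endpoints\<close>

text \<open>Lower bounds on ranks come from distinct representatives, chosen here as a map from
  indices to elements, opposite to the direction in \<open>partial_transversal\<close>.\<close>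

lemma card_le_rk_image_mset:
  assumes "finite I" "K \<subseteq> I" "inj_on \<psi> K" "\<And>k. k \<in> K \<Longrightarrow> \<psi> k \<in> A k" "\<psi> ` K \<subseteq> X"
  shows "card K \<le> rk (image_mset A (mset_set I)) X"
proof -
  have "card Z \<le> hits (image_mset A (mset_set I)) Z" if Z: "Z \<subseteq> \<psi> ` K" for Z
  proof -
    obtain J where J: "J \<subseteq> K" "Z = \<psi> ` J" using Z unfolding subset_image_iff by blast
    have "card Z \<le> card J"
      using J assms(1,2) by (metis card_image_le finite_subset)
    also have "J \<subseteq> {i \<in> I. A i \<inter> Z \<noteq> {}}" using J assms(2,4) by blast
    then have "card J \<le> card {i \<in> I. A i \<inter> Z \<noteq> {}}" using assms(1) by (intro card_mono) auto
    finally show ?thesis using assms(1) by (simp add: hits_image_mset)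
  qed
  moreover have "finite (\<psi> ` K)" using assms(1,2) finite_subset by blast
  ultimately have "partial_transversal (image_mset A (mset_set I)) (\<psi> ` K)"
    by (simp add: partial_transversal_iff)
  then have "card (\<psi> ` K) \<le> rk (image_mset A (mset_set I)) X" by (rule card_le_rk[OF assms(5)])
  then show ?thesis using assms(3) by (simp add: card_image)
qed

text \<open>Everything that lattice paths contribute: both ends of the \<open>i\<close>-th interval
  increase strictly with \<open>i\<close>, within a ground set of \<open>n\<close> elements.\<close>

locale increasing_intervals =
  fixes r n :: nat and l g :: "nat \<Rightarrow> nat"
  assumes l_less: "1 \<le> i \<Longrightarrow> i < k \<Longrightarrow> k \<le> r \<Longrightarrow> l i < l k"
    and g_less: "1 \<le> i \<Longrightarrow> i < k \<Longrightarrow> k \<le> r \<Longrightarrow> g i < g k"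
    and bounds: "1 \<le> i \<Longrightarrow> i \<le> r \<Longrightarrow> 1 \<le> l i \<and> l i \<le> g i \<and> g i \<le> n"
begin

definition intervals :: "nat set multiset" where
  "intervals = image_mset (\<lambda>i. {l i..g i}) (mset_set {1..r})"

definition plus_run :: "nat \<Rightarrow> nat set" where
  "plus_run i = {g i + j | j. 0 < j \<and> i + j \<le> r \<and> g i + j = g (i + j)}"

definition minus_run :: "nat \<Rightarrow> nat set" where
  "minus_run i = {l i - j | j. 0 < j \<and> j < i \<and> l i - j = l (i - j)}"

definition extension :: "nat \<Rightarrow> nat set" where
  "extension i = {l i..g i} \<union> plus_run i \<union> minus_run i"

lemma hits_intervals: "hits intervals Z = card {i \<in> {1..r}. {l i..g i} \<inter> Z \<noteq> {}}"
  by (simp add: intervals_def hits_image_mset)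

lemma card_le_rk_intervals:
  assumes "K \<subseteq> {1..r}" "inj_on \<psi> K" "\<And>k. k \<in> K \<Longrightarrow> l k \<le> \<psi> k \<and> \<psi> k \<le> g k \<and> \<psi> k \<in> X"
  shows "card K \<le> rk intervals X"
  unfolding intervals_def using assms by (intro card_le_rk_image_mset[of _ _ \<psi>]) auto

lemma size_intervals: "size intervals = r"
  by (simp add: intervals_def)

text \<open>Since consecutive ends differ by at least one, equality here forces each difference to
  be exactly one. With \<open>g_add\<close> this makes the runs contiguous.\<close>

lemma l_add: "1 \<le> i \<Longrightarrow> i + j \<le> r \<Longrightarrow> l i + j \<le> l (i + j)"
proof (induction j)
  case (Suc j)
  then show ?case using l_less[of "i + j" "i + Suc j"] by simp
qed simp

lemma g_add: "1 \<le> i \<Longrightarrow> i + j \<le> r \<Longrightarrow> g i + j \<le> g (i + j)"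
proof (induction j)
  case (Suc j)
  then show ?case using g_less[of "i + j" "i + Suc j"] by simp
qed simp

lemma minus_run_less: "1 \<le> i \<Longrightarrow> i \<le> r \<Longrightarrow> x \<in> minus_run i \<Longrightarrow> 1 \<le> x \<and> x < l i"
  using bounds[of "i - j" for j] l_less[of "i - j" i for j] by (fastforce simp: minus_run_def)

lemma plus_run_greater: "1 \<le> i \<Longrightarrow> i \<le> r \<Longrightarrow> x \<in> plus_run i \<Longrightarrow> g i < x \<and> x \<le> n"
  using bounds by (fastforce simp: plus_run_def)

lemma extension_subset: "1 \<le> i \<Longrightarrow> i \<le> r \<Longrightarrow> extension i \<subseteq> {1..n}"
  using minus_run_less[of i] plus_run_greater[of i] bounds[of i]
  by (fastforce simp: extension_def)

text \<open>Left ends represent the intervals before the \<open>i\<close>-th, right ends those after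
  it; these \<open>r - 1\<close> representatives are distinct and avoid the \<open>i\<close>-th
  interval.\<close>

lemma rk_outside_interval:
  assumes i: "1 \<le> i" "i \<le> r"
  shows "r \<le> rk intervals ({1..n} - {l i..g i}) + 1"
proof -
  define \<psi> where "\<psi> = (\<lambda>k. if k < i then l k else g k)"
  have side: "\<psi> k < l i \<longleftrightarrow> k < i" "k > i \<Longrightarrow> \<psi> k > g i" if "k \<in> {1..r} - {i}" for k
    using that i l_less[of k i] g_less[of i k] bounds[of i] by (auto simp: \<psi>_def)
  have "card ({1..r} - {i}) \<le> rk intervals ({1..n} - {l i..g i})"
  proof (rule card_le_rk_intervals)
    show "inj_on \<psi> ({1..r} - {i})"
    proof (rule linorder_inj_onI)
      fix j k assume jk: "j < k" "j \<in> {1..r} - {i}" "k \<in> {1..r} - {i}"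
      show "\<psi> j \<noteq> \<psi> k"
        using jk side[of j] side[of k] l_less[of j k] g_less[of j k]
        by (auto simp: \<psi>_def split: if_splits)
    qed auto
    show "l k \<le> \<psi> k \<and> \<psi> k \<le> g k \<and> \<psi> k \<in> {1..n} - {l i..g i}" if k: "k \<in> {1..r} - {i}" for k
      using k side[OF k] bounds[of k] by (cases "k < i") (auto simp: \<psi>_def)
  qed auto
  then show ?thesis using i by simp
qed

text \<open>For \<open>x = g (i + j)\<close> the \<open>j + 1\<close> intervals from
  \<open>i\<close> to \<open>i + j\<close> lie in \<open>{l i..x}\<close>, and only
  \<open>j - 1\<close> elements lie strictly between \<open>g i\<close> and \<open>x\<close>. So the
  rank is at most \<open>r - 2\<close>, and by \<open>rk_outside_interval\<close> deleting
  \<open>x\<close> has lowered it.\<close>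

lemma rk_outside_interval_plus:
  assumes "1 \<le> i" "i \<le> r" "x \<in> plus_run i"
  shows "rk intervals ({1..n} - {l i..g i} - {x}) + 2 \<le> r"
proof -
  from assms obtain j where j: "0 < j" "i + j \<le> r" "x = g i + j" "g (i + j) = g i + j"
    unfolding plus_run_def by (smt (verit) mem_Collect_eq)
  let ?X = "{1..n} - {l i..g i} - {x}" and ?Y = "{..<l i} \<union> {x<..}"
  have "{k \<in> {1..r}. {l k..g k} \<inter> ?Y \<noteq> {}} \<subseteq> {1..<i} \<union> {i + j<..r}"
  proof
    fix k assume "k \<in> {k \<in> {1..r}. {l k..g k} \<inter> ?Y \<noteq> {}}"
    then have k: "1 \<le> k" "k \<le> r" "l k < l i \<or> g (i + j) < g k" using j by auto
    have "k < i" if "l k < l i" using l_less[of i k] that k assms(1)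
      by (cases i k rule: linorder_cases) auto
    moreover have "i + j < k" if "g (i + j) < g k"
      using g_less[of k "i + j"] that k j by (cases "i + j" k rule: linorder_cases) auto
    ultimately show "k \<in> {1..<i} \<union> {i + j<..r}" using k by auto
  qed
  then have "hits intervals ?Y \<le> card ({1..<i} \<union> {i + j<..r})"
    unfolding hits_intervals by (intro card_mono) auto
  also have "\<dots> \<le> (i - 1) + (r - (i + j))" using card_Un_le[of "{1..<i}" "{i + j<..r}"] by simp
  finally have "hits intervals ?Y \<le> (i - 1) + (r - (i + j))" .
  moreover have "card (?X - ?Y) \<le> card {g i<..<x}" by (intro card_mono) auto
  moreover have "rk intervals ?X \<le> hits intervals ?Y + card (?X - ?Y)" by (intro rk_le_hits) auto
  ultimately show ?thesis using j assms(1) by simp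
qed

lemma rk_outside_interval_minus:
  assumes "1 \<le> i" "i \<le> r" "x \<in> minus_run i"
  shows "rk intervals ({1..n} - {l i..g i} - {x}) + 2 \<le> r"
proof -
  from assms obtain j where j: "0 < j" "j < i" "x = l (i - j)" "l i - j = l (i - j)"
    by (auto simp: minus_run_def)
  let ?X = "{1..n} - {l i..g i} - {x}" and ?Y = "{..<x} \<union> {g i<..}"
  have "{k \<in> {1..r}. {l k..g k} \<inter> ?Y \<noteq> {}} \<subseteq> {1..<i - j} \<union> {i<..r}"
  proof
    fix k assume "k \<in> {k \<in> {1..r}. {l k..g k} \<inter> ?Y \<noteq> {}}"
    then have k: "1 \<le> k" "k \<le> r" "l k < l (i - j) \<or> g i < g k" using j by auto
    have "1 \<le> i - j" using j by simp
    then have "k < i - j" if "l k < l (i - j)"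
      using l_less[of "i - j" k] that k j by (cases "i - j" k rule: linorder_cases) auto
    moreover have "i < k" if "g i < g k"
      using g_less[of k i] that k assms(2) by (cases i k rule: linorder_cases) auto
    ultimately show "k \<in> {1..<i - j} \<union> {i<..r}" using k by auto
  qed
  then have "hits intervals ?Y \<le> card ({1..<i - j} \<union> {i<..r})"
    unfolding hits_intervals by (intro card_mono) auto
  also have "\<dots> \<le> (i - j - 1) + (r - i)" using card_Un_le[of "{1..<i - j}" "{i<..r}"] by simp
  finally have "hits intervals ?Y \<le> (i - j - 1) + (r - i)" .
  moreover have "card (?X - ?Y) \<le> card {x<..<l i}" by (intro card_mono) auto
  moreover have "rk intervals ?X \<le> hits intervals ?Y + card (?X - ?Y)" by (intro rk_le_hits) auto
  \<comment> \<open>Positivity of \<open>x\<close> shows that \<open>l i - j\<close> is not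
    truncated, so exactly \<open>j - 1\<close> elements lie between \<open>x\<close> and
    \<open>l i\<close>.\<close>
  moreover have "1 \<le> x" using j(1-3) bounds[of "i - j"] assms(2) by simp
  then have "card {x<..<l i} = j - 1" using j(3,4) unfolding card_greaterThanLessThan by linarith
  ultimately show ?thesis using j(1,2) assms(2) by linarith
qed

text \<open>All new elements are added at once: the isthmus condition of
  \<open>partial_transversal_enlarge\<close> refers to the old system only, so each element is
  checked separately.\<close>

lemma partial_transversal_extension:
  "partial_transversal (image_mset extension (mset_set {1..r})) = partial_transversal intervals"
proof (rule partial_transversal_enlarge)
  show "rel_mset (\<lambda>A B. A \<subseteq> B \<and> B \<subseteq> {1..n} \<and>
      (\<forall>x\<in>B - A. rk intervals ({1..n} - A - {x}) \<noteq> rk intervals ({1..n} - A)))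
    intervals (image_mset extension (mset_set {1..r}))"
    \<comment> \<open>This exposes the indexing but also unfolds \<open>intervals\<close> inside
      \<open>rk\<close>, where it is folded back next.\<close>
    unfolding intervals_def
  proof (rule rel_mset_image_mset, unfold intervals_def[symmetric])
    fix i assume "i \<in> {1..r}"
    then have i: "1 \<le> i" "i \<le> r" by auto
    have "rk intervals ({1..n} - {l i..g i} - {x}) \<noteq> rk intervals ({1..n} - {l i..g i})"
      if "x \<in> extension i - {l i..g i}" for x
      using that rk_outside_interval[OF i] rk_outside_interval_plus[OF i, of x]
        rk_outside_interval_minus[OF i, of x] by (auto simp: extension_def)
    then show "{l i..g i} \<subseteq> extension i \<and> extension i \<subseteq> {1..n} \<and>
        (\<forall>x\<in>extension i - {l i..g i}.
          rk intervals ({1..n} - {l i..g i} - {x}) \<noteq> rk intervals ({1..n} - {l i..g i}))"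
      using extension_subset[OF i] by (auto simp: extension_def)
  qed simp
qed simp

text \<open>The added runs are contiguous, so the extension is again an interval, bounded by the
  ends at which the runs stop. Maximality of the runs yields the gaps beyond these ends.\<close>

lemma extension_eq_interval:
  assumes i: "1 \<le> i" "i \<le> r"
  obtains w u where "1 \<le> w" "w \<le> i" "i \<le> u" "u \<le> r" "extension i = {l w..g u}"
    and "u < r \<Longrightarrow> g u + 1 < g (u + 1)" and "1 < w \<Longrightarrow> l (w - 1) + 1 < l w"
proof -
  \<comment> \<open>\<open>a\<close> and \<open>b\<close> are the lengths of the two runs; zero
    always qualifies, so the greatest values exist. The condition for \<open>b\<close> is additive
    to avoid truncated subtraction.\<close>
  define a where "a = (GREATEST j. i + j \<le> r \<and> g (i + j) = g i + j)"
  define b where "b = (GREATEST j. j < i \<and> l i = l (i - j) + j)"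
  have a: "i + a \<le> r" "g (i + a) = g i + a"
    and a_max: "\<And>j. i + j \<le> r \<Longrightarrow> g (i + j) = g i + j \<Longrightarrow> j \<le> a"
    using GreatestI_nat[of "\<lambda>j. i + j \<le> r \<and> g (i + j) = g i + j" 0 r]
      Greatest_le_nat[of "\<lambda>j. i + j \<le> r \<and> g (i + j) = g i + j" _ r] i
    by (auto simp: a_def)
  have b: "b < i" "l i = l (i - b) + b"
    and b_max: "\<And>j. j < i \<Longrightarrow> l i = l (i - j) + j \<Longrightarrow> j \<le> b"
    using GreatestI_nat[of "\<lambda>j. j < i \<and> l i = l (i - j) + j" 0 i]
      Greatest_le_nat[of "\<lambda>j. j < i \<and> l i = l (i - j) + j" _ i] i
    by (auto simp: b_def)
  have plus: "plus_run i = {g i<..g i + a}"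
  proof (intro set_eqI iffI)
    fix x assume "x \<in> plus_run i"
    then obtain j where j: "0 < j" "i + j \<le> r" "x = g i + j" "g i + j = g (i + j)"
      unfolding plus_run_def by blast
    then have "j \<le> a" using a_max by simp
    then show "x \<in> {g i<..g i + a}" using j(1,3) by simp
  next
    fix x assume x: "x \<in> {g i<..g i + a}"
    define j where "j = x - g i"
    have j: "0 < j" "j \<le> a" "x = g i + j" using x by (auto simp: j_def)
    have "g (i + j) + (a - j) \<le> g (i + a)" using g_add[of "i + j" "a - j"] j i a by simp
    then have "g (i + j) = g i + j" using g_add[of i j] i a j by simp
    then show "x \<in> plus_run i" using j a by (auto simp: plus_run_def intro!: exI[of _ j])
  qed
  have minus: "minus_run i = {l (i - b)..<l i}"
  proof (intro set_eqI iffI)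
    fix x assume x: "x \<in> minus_run i"
    then obtain j where j: "0 < j" "j < i" "x = l i - j" "l i - j = l (i - j)"
      by (auto simp: minus_run_def)
    then have "l i = l (i - j) + j" using bounds[of "i - j"] i by linarith
    then have "j \<le> b" using b_max j by blast
    then show "x \<in> {l (i - b)..<l i}" using j b minus_run_less[OF i x] by auto
  next
    fix x assume x: "x \<in> {l (i - b)..<l i}"
    define j where "j = l i - x"
    have j: "0 < j" "j \<le> b" "x = l i - j" using x b by (auto simp: j_def)
    have "l (i - b) + (b - j) \<le> l (i - j)" using l_add[of "i - b" "b - j"] j i b by simp
    moreover have "l (i - j) + j \<le> l i" using l_add[of "i - j" j] j i b by simp
    ultimately have "l i - j = l (i - j)" using b j by linarith
    then show "x \<in> minus_run i" using j b by (auto simp: minus_run_def intro!: exI[of _ j])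
  qed
  have "extension i = {l (i - b)..g (i + a)}"
    using plus minus a b bounds[OF i] by (auto simp: extension_def)
  moreover have "g (i + a) + 1 < g (i + a + 1)" if "i + a < r"
    using a_max[of "a + 1"] a g_less[of "i + a" "i + a + 1"] that i by fastforce
  moreover have "l (i - b - 1) + 1 < l (i - b)" if "1 < i - b"
    using b_max[of "b + 1"] b l_less[of "i - b - 1" "i - b"] that i by fastforce
  ultimately show thesis using that[of "i - b" "i + a"] a b i by simp
qed

text \<open>A set \<open>N\<^sub>k\<close> that leaves \<open>[l\<^sub>w, g\<^sub>u]\<close> does so at one end. Given \<open>x\<close> to be avoided beyond
  \<open>g\<^sub>u\<close>, the greatest elements of the \<open>N\<^sub>k\<close> with \<open>k > u\<close> are moved down by one as far as \<open>x\<close>; the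
  gap after \<open>g\<^sub>u\<close> leaves room for this. The other side is symmetric.\<close>

lemma cyclic_outside_extension:
  assumes nontrivial: "\<And>k. 1 \<le> k \<Longrightarrow> k \<le> r \<Longrightarrow> l k < g k" and i: "1 \<le> i" "i \<le> r"
  shows "cyclic intervals ({1..n} - extension i)"
proof -
  obtain w u where wu: "1 \<le> w" "w \<le> i" "i \<le> u" "u \<le> r" and ext: "extension i = {l w..g u}"
    and gap_u: "u < r \<Longrightarrow> g u + 1 < g (u + 1)" and gap_w: "1 < w \<Longrightarrow> l (w - 1) + 1 < l w"
    using extension_eq_interval[OF i] by blast
  let ?X = "{1..n} - {l w..g u}" and ?K = "{1..<w} \<union> {u<..r}"
  have l_le: "l j \<le> l k" if "1 \<le> j" "j \<le> k" "k \<le> r" for j k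
    using l_less[of j k] that by (cases "j = k") auto
  have g_le: "g j \<le> g k" if "1 \<le> j" "j \<le> k" "k \<le> r" for j k
    using g_less[of j k] that by (cases "j = k") auto
  have "l w \<le> g u" using bounds[of w] g_le[of w u] wu by simp
  have above: "g u + 1 < g k" if "u < k" "k \<le> r" for k
    using gap_u g_le[of "u + 1" k] that by simp
  have below: "l k + 1 < l w" if "1 \<le> k" "k < w" for k
    using gap_w l_le[of k "w - 1"] that wu by fastforce
  \<comment> \<open>The intervals from \<open>w\<close> to \<open>u\<close> lie inside
    \<open>{l w..g u}\<close>, so only the others can meet \<open>?X\<close>.\<close>
  have "{k \<in> {1..r}. {l k..g k} \<inter> ?X \<noteq> {}} \<subseteq> ?K"
  proof
    fix k assume k: "k \<in> {k \<in> {1..r}. {l k..g k} \<inter> ?X \<noteq> {}}"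
    show "k \<in> ?K"
    proof (rule ccontr)
      assume "k \<notin> ?K"
      then have "l w \<le> l k" "g k \<le> g u" using k wu l_le[of w k] g_le[of k u] by auto
      then show False using k by auto
    qed
  qed
  then have "hits intervals ?X \<le> card ?K"
    unfolding hits_intervals by (intro card_mono) auto
  moreover have "card ?K \<le> rk intervals (?X - {x})" if x: "x \<in> ?X" for x
  proof -
    \<comment> \<open>If \<open>x\<close> lies on the left, the left ends from \<open>x\<close>
      upwards are raised by one; if on the right, the right ends up to \<open>x\<close> are lowered
      by one. By \<open>nontrivial\<close> the shifted values stay in their intervals.\<close>
    define \<psi> where "\<psi> k = (if k < w then (if x < l w \<and> x \<le> l k then l k + 1 else l k)
      else (if g u < x \<and> g k \<le> x then g k - 1 else g k))" for k
    have left: "\<psi> k < l w" "l k \<le> \<psi> k" "\<psi> k \<le> g k" "\<psi> k \<noteq> x" if "1 \<le> k" "k < w" for k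
      using that below[of k] nontrivial[of k] wu x \<open>l w \<le> g u\<close> by (auto simp: \<psi>_def)
    have right: "g u < \<psi> k" "l k \<le> \<psi> k" "\<psi> k \<le> g k" "\<psi> k \<noteq> x" if "u < k" "k \<le> r" for k
      using that above[of k] nontrivial[of k] wu x \<open>l w \<le> g u\<close> by (auto simp: \<psi>_def)
    show ?thesis
    proof (rule card_le_rk_intervals)
      show "inj_on \<psi> ?K"
      proof (rule linorder_inj_onI)
        fix j k assume jk: "j < k" "j \<in> ?K" "k \<in> ?K"
        consider "k < w" | "u < j" | "j < w" "u < k" using jk wu by fastforce
        then show "\<psi> j \<noteq> \<psi> k"
        proof cases
          case 1
          then show ?thesis using jk l_less[of j k] wu by (auto simp: \<psi>_def split: if_splits)
        next
          case 2
          then show ?thesis using jk g_less[of j k] above[of j] wu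
            by (auto simp: \<psi>_def split: if_splits)
        next
          case 3
          then show ?thesis using jk left(1)[of j] right(1)[of k] wu \<open>l w \<le> g u\<close> by auto
        qed
      qed auto
      show "l k \<le> \<psi> k \<and> \<psi> k \<le> g k \<and> \<psi> k \<in> ?X - {x}" if "k \<in> ?K" for k
        using that left[of k] right[of k] bounds[of k] wu \<open>l w \<le> g u\<close> by auto
    qed (use wu in auto)
  qed
  \<comment> \<open>This closes the chain from \<open>hits intervals ?X\<close> through
    \<open>card ?K\<close> and \<open>rk intervals (?X - {x})\<close> back to
    \<open>hits intervals ?X\<close>, so all are equal.\<close>
  moreover have "rk intervals ?X \<le> hits intervals ?X" using rk_le_hits[of ?X intervals ?X] by simp
  moreover have "rk intervals (?X - {x}) \<le> rk intervals ?X" for x by (rule rk_mono) blast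
  ultimately show ?thesis unfolding ext cyclic_def by (meson le_antisym le_trans)
qed

section \<open>Rank, isthmuses and maximal presentation for interval systems\<close>

lemma rank_intervals: "rank (transversal_matroid {1..n} intervals) = r"
proof -
  \<comment> \<open>The \<open>r\<close> left ends are distinct representatives.\<close>
  have "r \<le> rk intervals {1..n}"
    using card_le_rk_intervals[of "{1..r}" l "{1..n}"] bounds l_less
    by (force simp: intro!: linorder_inj_onI)
  then obtain B where B: "partial_transversal intervals B" "r \<le> card B"
    using rk_witness[of "{1..n}" intervals] by auto
  then obtain C where C: "C \<in> maximal_partial_transversals intervals" "B \<subseteq> C"
    using partial_transversal_extends by blast
  have le: "card D \<le> r" if "D \<in> maximal_partial_transversals intervals" for D
    using that card_partial_transversal_le[of intervals D] size_intervals
    by (simp add: maximal_partial_transversals_def)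
  have "finite C" using C(1) by (simp add: maximal_partial_transversals_def partial_transversal_iff)
  then have "card C = r" using C le[of C] B card_mono[of C B] by simp
  then show ?thesis
    unfolding rank_def transversal_matroid_def using C le
    by (intro Max_eqI) (auto intro: finite_subset[of _ "{..r}"])
qed

text \<open>The member \<open>{l i}\<close> is met by no element but \<open>l i\<close>, so adding
  \<open>l i\<close> to a partial transversal keeps Hall's condition. Hence without isthmuses all
  intervals have at least two elements.\<close>

lemma isthmus_trivial_interval:
  assumes i: "1 \<le> i" "i \<le> r" and "l i = g i"
  shows "isthmus (transversal_matroid {1..n} intervals) (l i)"
proof -
  have "l i \<in> B" if B: "B \<in> maximal_partial_transversals intervals" for B
  proof -
    obtain \<C> where \<C>: "intervals = add_mset {l i} \<C>"
    proof
      show "intervals = add_mset {l i} (image_mset (\<lambda>i. {l i..g i}) (mset_set ({1..r} - {i})))"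
        using i assms(3) by (simp add: intervals_def mset_set.remove[of _ i])
    qed
    have PT: "finite B" "\<And>Z. Z \<subseteq> B \<Longrightarrow> card Z \<le> hits intervals Z"
      using B by (auto simp: maximal_partial_transversals_def partial_transversal_iff)
    have "card Z \<le> hits intervals Z" if Z: "Z \<subseteq> insert (l i) B" for Z
    proof (cases "l i \<in> Z")
      case True
      have "card (Z - {l i}) \<le> hits intervals (Z - {l i})" using Z by (intro PT) auto
      moreover have "hits \<C> (Z - {l i}) \<le> hits \<C> Z" by (rule hits_mono) blast
      moreover have "finite Z" using Z PT(1) by (rule finite_subset[OF _ finite.insertI])
      then have "card Z = Suc (card (Z - {l i}))" using True by (rule card.remove)
      moreover have "hits intervals Z = Suc (hits \<C> Z)"
        "hits intervals (Z - {l i}) = hits \<C> (Z - {l i})"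
        using True by (simp_all add: \<C>)
      ultimately show ?thesis by linarith
    next
      case False
      then show ?thesis using Z by (intro PT) auto
    qed
    then have "partial_transversal intervals (insert (l i) B)"
      using PT(1) by (simp add: partial_transversal_iff)
    then show ?thesis using B by (auto simp: maximal_partial_transversals_def)
  qed
  then show ?thesis using bounds[OF i] by (auto simp: isthmus_def transversal_matroid_def)
qed

theorem maximal_presentation_intervals_iff:
  assumes "\<nexists>e. isthmus (transversal_matroid {1..n} intervals) e"
  shows "maximal_presentation (transversal_matroid {1..n} intervals) \<A> \<longleftrightarrow>
    \<A> = image_mset extension (mset_set {1..r})" (is "maximal_presentation ?M \<A> \<longleftrightarrow> \<A> = ?E")
proof -
  have nontrivial: "l k < g k" if "1 \<le> k" "k \<le> r" for k
    using isthmus_trivial_interval[OF that] bounds[OF that] assms by fastforce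
  have ground: "ground ?M = {1..n}" "bases ?M = maximal_partial_transversals intervals"
    by (simp_all add: transversal_matroid_def)
  have "maximal_partial_transversals ?E = maximal_partial_transversals intervals"
    unfolding maximal_partial_transversals_def partial_transversal_extension ..
  moreover have "\<forall>A\<in>#?E. A \<subseteq> {1..n}" using extension_subset by auto
  ultimately have pres: "presentation ?M ?E"
    unfolding presentation_def ground rank_intervals by simp
  \<comment> \<open>Being cyclic depends only on the partial transversals, which \<open>?E\<close>
    shares with \<open>intervals\<close>.\<close>
  have "cyclic ?E = cyclic intervals"
    unfolding cyclic_def[abs_def] rk_cong[OF partial_transversal_extension] ..
  then have "maximal_presentation ?M ?E"
    using cyclic_outside_extension[OF nontrivial] maximal_presentation_iff[OF _ pres] ground by auto
  then show ?thesis using maximal_presentation_unique[of ?M] ground by auto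
qed

end

section \<open>Lattice paths between two bounding paths\<close>

definition height :: "step list \<Rightarrow> nat \<Rightarrow> nat" where
  "height R k = count_list (take k R) North"

lemma count_East_North: "count_list R East + count_list R North = length R"
proof (induction R)
  case (Cons s R)
  then show ?case by (cases s) auto
qed simp

lemma height_0 [simp]: "height R 0 = 0"
  by (simp add: height_def)

lemma height_Suc:
  "k < length R \<Longrightarrow> height R (Suc k) = height R k + (if R ! k = North then 1 else 0)"
  by (simp add: height_def take_Suc_conv_app_nth)

lemma height_Suc_bounds:
  shows "height R k \<le> height R (Suc k)" and "height R (Suc k) \<le> Suc (height R k)"
proof -
  have "height R (Suc k) = height R k" if "\<not> k < length R"
    using that by (simp add: height_def)
  then show "height R k \<le> height R (Suc k)" "height R (Suc k) \<le> Suc (height R k)"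
    using height_Suc[of k R] by (cases "k < length R"; simp)+
qed

lemma height_mono: "j \<le> k \<Longrightarrow> height R j \<le> height R k"
  by (rule lift_Suc_mono_le[of "height R"]) (rule height_Suc_bounds)

lemma height_le: "height R k \<le> k"
proof (induction k)
  case (Suc k)
  then show ?case using height_Suc_bounds(2)[of R k] by simp
qed simp

lemma lattice_path_length: "lattice_path m r R \<Longrightarrow> length R = m + r"
  using count_East_North[of R] by (simp add: lattice_path_def)

lemma height_end: "lattice_path m r R \<Longrightarrow> height R (m + r) = r"
  using lattice_path_length[of m r R] by (simp add: height_def lattice_path_def)

lemma path_points_eq: "path_points R = {(k - height R k, height R k) | k. k \<le> length R}"
proof -
  have "count_list (take k R) East = k - height R k" if "k \<le> length R" for k
    using count_East_North[of "take k R"] that by (simp add: height_def)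
  then show ?thesis unfolding path_points_def height_def[symmetric] by metis
qed

text \<open>Passes from comparison on vertical lines to comparison after equally many steps. Both
  coordinates are monotone along a path: a later point of \<open>R\<close> in the same column is
  handled by its East coordinate, an earlier one by its height.\<close>

lemma never_above_iff:
  assumes "lattice_path m r P" "lattice_path m r R"
  shows "never_above P R \<longleftrightarrow> (\<forall>k\<le>m + r. height P k \<le> height R k)"
proof
  assume above: "never_above P R"
  show "\<forall>k\<le>m + r. height P k \<le> height R k"
  proof (intro allI impI)
    fix k assume "k \<le> m + r"
    then have "(k - height P k, height P k) \<in> path_points P"
      using lattice_path_length[OF assms(1)] by (auto simp: path_points_eq)
    then obtain y where "y \<ge> height P k" "(k - height P k, y) \<in> path_points R"
      using above unfolding never_above_def by fast
    then obtain k' where k': "k - height P k = k' - height R k'" "height P k \<le> height R k'"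
      by (auto simp: path_points_eq)
    show "height P k \<le> height R k"
    proof (cases "k \<le> k'")
      case True
      have "height R k' - height R k \<le> k' - k"
        using True
      proof (induction k' rule: dec_induct)
        case (step j)
        then show ?case using height_Suc_bounds[of R j] by linarith
      qed simp
      then show ?thesis using k' height_le[of R k'] height_le[of P k] True by linarith
    next
      case False
      then show ?thesis using k' height_mono[of k' k R] by linarith
    qed
  qed
next
  assume le: "\<forall>k\<le>m + r. height P k \<le> height R k"
  have "\<exists>y\<ge>height P k. (k - height P k, y) \<in> path_points R" if k: "k \<le> m + r" for k
  proof -
    \<comment> \<open>The East coordinate of \<open>R\<close>, as an integer for the discrete
      intermediate value theorem. At \<open>k\<close> it is at most that of \<open>P\<close> and it
      ends at \<open>m\<close>, so \<open>R\<close> reaches the column at step \<open>k\<close> or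
      later.\<close>
    let ?f = "\<lambda>j. int j - int (height R j)"
    have "\<exists>j\<ge>k. j \<le> m + r \<and> ?f j = int k - int (height P k)"
    proof (rule nat_intermed_int_val)
      show "\<forall>j. k \<le> j \<and> j < m + r \<longrightarrow> \<bar>?f (Suc j) - ?f j\<bar> \<le> 1"
        using height_Suc_bounds[of R] by (auto simp: abs_le_iff) (smt (verit) of_nat_Suc of_nat_le_iff)+
      have "(k - height P k) + height R (m + r) \<le> m + r"
      proof -
        have "count_list P East = count_list (take k P) East + count_list (drop k P) East"
          by (metis append_take_drop_id count_list_append)
        then have "count_list (take k P) East \<le> m" using assms(1) by (simp add: lattice_path_def)
        then show ?thesis
          using count_East_North[of "take k P"] k lattice_path_length[OF assms(1)] height_end[OF assms(2)]
          by (simp add: height_def)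
      qed
      then show "int k - int (height P k) \<le> ?f (m + r)" by linarith
    qed (use le k in auto)
    then obtain j where j: "k \<le> j" "j \<le> m + r" "?f j = int k - int (height P k)" by blast
    then have "k - height P k = j - height R j" by linarith
    moreover have "height P k \<le> height R j" using j(1) le k height_mono[of k j R] by (meson le_trans)
    ultimately show ?thesis
      using j(2) lattice_path_length[OF assms(2)] by (auto simp: path_points_eq)
  qed
  then show "never_above P R"
    using lattice_path_length[OF assms(1)] by (auto simp: never_above_def path_points_eq[of P])
qed

text \<open>Paths can be prescribed by their heights: each increment determines a step, and the
  length fixes the number of East steps.\<close>

lemma lattice_path_of_heights:
  assumes "h 0 = 0" "h (m + r) = r" "\<And>k. k < m + r \<Longrightarrow> h (Suc k) = h k \<or> h (Suc k) = Suc (h k)"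
  shows "\<exists>R. lattice_path m r R \<and> (\<forall>k\<le>m + r. height R k = h k)"
proof -
  define R where "R = map (\<lambda>k. if h (Suc k) = h k then East else North) [0..<m + r]"
  have len: "length R = m + r" by (simp add: R_def)
  have "height R k = h k" if "k \<le> m + r" for k
    using that
  proof (induction k)
    case (Suc k)
    then show ?case using assms(3)[of k] len by (auto simp: height_Suc) (auto simp: R_def)
  qed (use assms(1) in simp)
  moreover from this[of "m + r"] have "lattice_path m r R"
    using count_East_North[of R] len assms(2) by (simp add: lattice_path_def height_def)
  ultimately show ?thesis by blast
qed

section \<open>The sets of possible North steps\<close>

lemma is_north_step_iff:
  "is_north_step R i j \<longleftrightarrow> 1 \<le> j \<and> j \<le> length R \<and> height R (j - 1) + 1 = i \<and> height R j = i"
proof (cases j)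
  case (Suc k)
  then show ?thesis
    by (auto simp: is_north_step_def height_def[symmetric] height_Suc Suc_le_eq split: if_splits)
qed (simp add: is_north_step_def)

text \<open>A path in between with \<open>i\<close>-th North step \<open>j\<close>: follow \<open>Q\<close> until height \<open>i - 1\<close>, go East
  up to step \<open>j\<close>, then stay at height \<open>i\<close> until \<open>P\<close> is met.\<close>

lemma north_set_eq:
  assumes P: "lattice_path m r P" and Q: "lattice_path m r Q" and "never_above P Q"
    and i: "1 \<le> i" "i \<le> r"
  shows "north_set m r P Q i = {j \<in> {1..m + r}. height P (j - 1) < i \<and> i \<le> height Q j}"
proof (intro set_eqI iffI)
  fix j assume "j \<in> north_set m r P Q i"
  then obtain R where R: "lattice_path m r R" "never_above P R" "never_above R Q" "is_north_step R i j"
    by (auto simp: north_set_def paths_between_def)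
  then have j: "1 \<le> j" "j \<le> m + r" "height R (j - 1) + 1 = i" "height R j = i"
    using lattice_path_length by (auto simp: is_north_step_iff)
  then have "height P (j - 1) \<le> height R (j - 1)" "height R j \<le> height Q j"
    using R never_above_iff P Q by auto
  then show "j \<in> {j \<in> {1..m + r}. height P (j - 1) < i \<and> i \<le> height Q j}" using j by auto
next
  fix j assume "j \<in> {j \<in> {1..m + r}. height P (j - 1) < i \<and> i \<le> height Q j}"
  then have j: "1 \<le> j" "j \<le> m + r" "height P (j - 1) < i" "i \<le> height Q j" by auto
  then obtain j' where j': "j = Suc j'" by (cases j) auto
  define h where "h k = (if k < j then min (height Q k) (i - 1) else max (height P k) i)" for k
  have PQ: "height P k \<le> height Q k" if "k \<le> m + r" for k
    using that assms(3) never_above_iff[OF P Q] by simp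
  \<comment> \<open>One step changes a height by at most one, so \<open>Q\<close> has height at
    least \<open>i - 1\<close> before step \<open>j\<close>, and \<open>P\<close> at most
    \<open>i\<close> after it.\<close>
  have "h j' = i - 1" "h j = i"
    using j j' height_Suc_bounds[of Q j'] height_Suc_bounds[of P j'] by (auto simp: h_def)
  moreover have "h (Suc k) = h k \<or> h (Suc k) = Suc (h k)" for k
  proof (cases "Suc k = j")
    case True
    then show ?thesis using \<open>h j' = i - 1\<close> \<open>h j = i\<close> i j' by auto
  next
    case False
    then show ?thesis
      using height_Suc_bounds[of Q k] height_Suc_bounds[of P k] by (auto simp: h_def min_def max_def)
  qed
  moreover have "h 0 = 0" "h (m + r) = r"
    using j i height_end[OF P] by (auto simp: h_def)
  ultimately obtain R where R: "lattice_path m r R" "\<And>k. k \<le> m + r \<Longrightarrow> height R k = h k"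
    using lattice_path_of_heights[of h m r] by blast
  have "height P k \<le> h k \<and> h k \<le> height Q k" if "k \<le> m + r" for k
  proof (cases "k < j")
    case True
    then have "height P k \<le> height P (j - 1)" by (intro height_mono) simp
    then show ?thesis using True PQ[OF that] j(3) by (simp add: h_def)
  next
    case False
    then show ?thesis using PQ[OF that] height_mono[of j k Q] j by (auto simp: h_def)
  qed
  then have "R \<in> paths_between m r P Q"
    using R never_above_iff[OF P R(1)] never_above_iff[OF R(1) Q] by (simp add: paths_between_def)
  moreover have "is_north_step R i j"
    using R(2) j j' i \<open>h j' = i - 1\<close> \<open>h j = i\<close> lattice_path_length[OF R(1)]
    by (simp add: is_north_step_iff)
  ultimately show "j \<in> north_set m r P Q i" by (auto simp: north_set_def)
qed

lemma north_step_exists: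
  assumes "lattice_path m r R" "1 \<le> i" "i \<le> r"
  shows "\<exists>p. 1 \<le> p \<and> p \<le> m + r \<and> height R p = i \<and> height R (p - 1) < i"
proof -
  \<comment> \<open>The first time that height \<open>i\<close> is reached; since heights rise by at
    most one, it is reached exactly.\<close>
  define p where "p = (LEAST p. i \<le> height R p)"
  have end': "i \<le> height R (m + r)" using assms by (simp add: height_end)
  then have p: "i \<le> height R p" "p \<le> m + r"
    unfolding p_def by (auto intro: LeastI Least_le)
  have "p \<noteq> 0" using p(1) assms(2) by (intro notI) simp
  then have "height R (p - 1) < i"
    using not_less_Least[of "p - 1" "\<lambda>p. i \<le> height R p"] by (simp add: p_def[symmetric])
  moreover have "height R p \<le> Suc (height R (p - 1))"
    using height_Suc_bounds(2)[of R "p - 1"] \<open>p \<noteq> 0\<close> by simp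
  ultimately show ?thesis using p \<open>p \<noteq> 0\<close> by (intro exI[of _ p]) auto
qed

text \<open>\<open>l i\<close> is the \<open>i\<close>-th North step of the upper path
  \<open>Q\<close> and \<open>g i\<close> that of the lower path \<open>P\<close>. The two height
  conditions in \<open>north_set_eq\<close> then become \<open>l i \<le> j\<close> and
  \<open>j \<le> g i\<close>.\<close>

lemma north_set_increasing_intervals:
  assumes P: "lattice_path m r P" and Q: "lattice_path m r Q" and above: "never_above P Q"
  shows "\<exists>l g. increasing_intervals r (m + r) l g \<and> (\<forall>i\<in>{1..r}. north_set m r P Q i = {l i..g i})"
proof -
  obtain l where l: "\<And>i. 1 \<le> i \<Longrightarrow> i \<le> r \<Longrightarrow>
      1 \<le> l i \<and> l i \<le> m + r \<and> height Q (l i) = i \<and> height Q (l i - 1) < i"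
    using north_step_exists[OF Q] by metis
  obtain g where g: "\<And>i. 1 \<le> i \<Longrightarrow> i \<le> r \<Longrightarrow>
      1 \<le> g i \<and> g i \<le> m + r \<and> height P (g i) = i \<and> height P (g i - 1) < i"
    using north_step_exists[OF P] by metis
  have l_iff: "i \<le> height Q j \<longleftrightarrow> l i \<le> j" if "1 \<le> i" "i \<le> r" for i j
    using l[OF that] height_mono[of "l i" j Q] height_mono[of j "l i - 1" Q] by linarith
  have g_iff: "height P (j - 1) < i \<longleftrightarrow> j \<le> g i" if "1 \<le> i" "i \<le> r" "1 \<le> j" for i j
    using g[OF that(1,2)] height_mono[of "g i" "j - 1" P] height_mono[of "j - 1" "g i - 1" P] that
    by linarith
  have "north_set m r P Q i = {l i..g i}" if i: "1 \<le> i" "i \<le> r" for i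
    using l[OF i] g[OF i] i by (auto simp: north_set_eq[OF P Q above i] l_iff g_iff[of i, simplified])
  moreover have "increasing_intervals r (m + r) l g"
  proof
    fix i k assume ik: "1 \<le> i" "i < k" "k \<le> r"
    show "l i < l k"
      using l[of i] l[of k] height_mono[of "l k" "l i" Q] ik by (auto simp: not_le[symmetric])
    show "g i < g k"
      using g[of i] g[of k] height_mono[of "g k" "g i" P] ik by (auto simp: not_le[symmetric])
  next
    fix i assume i: "1 \<le> i" "i \<le> r"
    have "height P (g i) \<le> height Q (g i)" using g[OF i] above never_above_iff[OF P Q] by blast
    then have "l i \<le> g i" using l_iff[OF i] g[OF i] by simp
    then show "1 \<le> l i \<and> l i \<le> g i \<and> g i \<le> m + r" using l[OF i] g[OF i] by simp
  qed
  ultimately show ?thesis by auto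
qed

theorem theorem6p4:
  fixes m r :: nat and P Q :: "step list" and \<A> :: "nat set multiset"
  assumes "lattice_path m r P" and "lattice_path m r Q"
    and "never_above P Q"
    and "\<nexists>e. isthmus (lattice_path_matroid m r P Q) e"
  shows "maximal_presentation (lattice_path_matroid m r P Q) \<A> \<longleftrightarrow>
    \<A> = image_mset (extended_north_set m r P Q) (mset_set {1..r})"
proof -
  obtain l g where incr: "increasing_intervals r (m + r) l g"
    and N: "\<And>i. 1 \<le> i \<Longrightarrow> i \<le> r \<Longrightarrow> north_set m r P Q i = {l i..g i}"
    using north_set_increasing_intervals[OF assms(1-3)] by auto
  interpret increasing_intervals r "m + r" l g by (rule incr)
  have matroid: "lattice_path_matroid m r P Q = transversal_matroid {1..m + r} intervals"
    unfolding lattice_path_matroid_def standard_presentation_def intervals_def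
    by (intro arg_cong[of _ _ "transversal_matroid _"] image_mset_cong) (simp add: N)
  have ends: "least_north m r P Q i = l i" "greatest_north m r P Q i = g i"
    if "1 \<le> i" "i \<le> r" for i
    using bounds[OF that]
    by (auto simp: least_north_def greatest_north_def N[OF that] intro: Min_eqI Max_eqI)
  have "extended_north_set m r P Q i = extension i" if i: "1 \<le> i" "i \<le> r" for i
  proof -
    \<comment> \<open>The guards in the definitions keep the indices in \<open>{1..r}\<close>, where
      the ends are known.\<close>
    have "greatest_north m r P Q (i + j) = g (i + j)" if "i + j \<le> r" for j
      using ends(2)[of "i + j"] i that by simp
    then have "I_plus m r P Q i = plus_run i"
      unfolding I_plus_def plus_run_def ends(2)[OF i] by (intro Collect_cong ex_cong1) auto
    moreover have "least_north m r P Q (i - j) = l (i - j)" if "j < i" for j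
      using ends(1)[of "i - j"] i that by simp
    then have "I_minus m r P Q i = minus_run i"
      unfolding I_minus_def minus_run_def ends(1)[OF i] by (intro Collect_cong ex_cong1) auto
    ultimately show ?thesis by (simp add: extended_north_set_def extension_def N[OF i])
  qed
  then have "image_mset (extended_north_set m r P Q) (mset_set {1..r}) =
      image_mset extension (mset_set {1..r})"
    by (intro image_mset_cong) simp
  then show ?thesis using maximal_presentation_intervals_iff assms(4) unfolding matroid by simp
qed

end
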